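(* Let $p,r\ge 1$ and $q\ge 2$ be integers, and let $\Gamma=\mathcal{C}_{p,q,r}$ with $p=r$ and $q$ arbitrary (less than, equal to, or greater than $r$). Then $$\beta(\Gamma)=\begin{cases}3 & \text{if } q-r=2 \text{ or } q-r=4,\\ 2 & \text{otherwise}.\end{cases}$$
   Context: For a connected graph $\Gamma$ with vertex set $V(\Gamma)$, $d(u,v)$ is the length (number of edges) of a shortest path between $u$ and $v$. For an ordered set $R=\{w_1,\dots,w_t\}\subseteq V(\Gamma)$, the representation of a vertex $v$ with respect to $R$ is $(d(v,w_1),\dots,d(v,w_t))$. $R$ is a resolving set if distinct vertices have distinct representations with respect to $R$. The metric dimension $\beta(\Gamma)$ is the minimum cardinality of a resolving set of $\Gamma$. The graph $\mathcal{C}_{p,q,r}$ (base bicyclic graph of type III), for integers $p,r\ge 1$ and $q\ge 2$, is defined as follows. Take three disjoint paths $\mathcal{P}_1=v_1\cdots v_p$, $\mathcal{P}_2=v_{p+1}\cdots v_{p+q}$ and $\mathcal{P}_3=v_{p+q+1}\cdots v_{p+q+r}$ having $p$, $q$ and $r$ vertices respectively; join the starting vertices $v_1$ and $v_{p+q+1}$ of $\mathcal{P}_1$ and $\mathcal{P}_3$ to the starting vertex $v_{p+1}$ of $\mathcal{P}_2$, and join the ending vertices $v_p$ and $v_{p+q+r}$ of $\mathcal{P}_1$ and $\mathcal{P}_3$ to the ending vertex $v_{p+q}$ of $\mathcal{P}_2$ (a one-vertex path has its starting vertex equal to its ending vertex). Thus $v_{p+1}$ and $v_{p+q}$ are joined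 by three internally disjoint paths of lengths $p+1$, $q-1$, $r+1$. *)

theory Defs
  imports "Graph_Theory.Graph_Theory"
begin

text \<open>Simple undirected graphs are loop-free symmetric digraphs without parallel arcs
  (locale \<^locale>\<open>pair_graph\<close>), so every edge is present as two opposite arcs.\<close>

text \<open>The list \<open>p\<close> is the list of arcs of the path, so its length is the number of edges.
  The value is meaningful only if \<open>v\<close> is reachable from \<open>u\<close>.\<close>

definition gdist :: "'a pair_pre_digraph \<Rightarrow> 'a \<Rightarrow> 'a \<Rightarrow> nat" where
  "gdist G u v = (LEAST n. \<exists>p. pre_digraph.apath (with_proj G) u p v \<and> length p = n)"

definition representation :: "'a pair_pre_digraph \<Rightarrow> 'a list \<Rightarrow> 'a \<Rightarrow> nat list" where
  "representation G ws v = map (gdist G v) ws"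

text \<open>Ordered vertex sets are lists without repetitions.\<close>

definition resolving_set :: "'a pair_pre_digraph \<Rightarrow> 'a list \<Rightarrow> bool" where
  "resolving_set G ws \<longleftrightarrow>
     distinct ws \<and> set ws \<subseteq> pverts G \<and>
     (\<forall>u \<in> pverts G. \<forall>v \<in> pverts G. u \<noteq> v \<longrightarrow> representation G ws u \<noteq> representation G ws v)"

definition metric_dimension :: "'a pair_pre_digraph \<Rightarrow> nat" where
  "metric_dimension G = (LEAST k. \<exists>ws. resolving_set G ws \<and> length ws = k)"

text \<open>The vertex \<open>v\<^sub>i\<close> is the number \<open>i\<close>. The first three sets are the edges of the three paths
  (empty for a path with one vertex); the last one joins the end vertices.\<close>

definition bicyclic3_edges :: "nat \<Rightarrow> nat \<Rightarrow> nat \<Rightarrow> nat rel" where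
  "bicyclic3_edges p q r =
     {(i, i + 1) | i. 1 \<le> i \<and> i < p} \<union>
     {(i, i + 1) | i. p + 1 \<le> i \<and> i < p + q} \<union>
     {(i, i + 1) | i. p + q + 1 \<le> i \<and> i < p + q + r} \<union>
     {(1, p + 1), (p + q + 1, p + 1), (p, p + q), (p + q + r, p + q)}"

definition bicyclic3 :: "nat \<Rightarrow> nat \<Rightarrow> nat \<Rightarrow> nat pair_pre_digraph" where
  "bicyclic3 p q r =
     \<lparr> pverts = {1..p + q + r},
       parcs = bicyclic3_edges p q r \<union> (bicyclic3_edges p q r)\<inverse> \<rparr>"

lemma bicyclic3_pair_graph:
  assumes "p \<ge> 1" "q \<ge> 2" "r \<ge> 1"
  shows "pair_graph (bicyclic3 p q r)"
proof -
  have sub: "parcs (bicyclic3 p q r) \<subseteq> {1..p + q + r} \<times> {1..p + q + r}"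
    using assms by (auto simp: bicyclic3_def bicyclic3_edges_def)
  have fin: "finite (parcs (bicyclic3 p q r))"
    by (rule finite_subset[OF sub]) simp
  have sym: "symmetric (with_proj (bicyclic3 p q r))"
    by (auto simp: symmetric_def sym_def bicyclic3_def)
  have loop: "fst e \<noteq> snd e" if "e \<in> parcs (bicyclic3 p q r)" for e
    using that assms by (auto simp: bicyclic3_def bicyclic3_edges_def)
  show ?thesis
  proof unfold_locales
    fix e assume "e \<in> parcs (bicyclic3 p q r)"
    with sub have "e \<in> {1..p + q + r} \<times> {1..p + q + r}" by blast
    then show "fst e \<in> pverts (bicyclic3 p q r)" "snd e \<in> pverts (bicyclic3 p q r)"
      by (auto simp: bicyclic3_def)
  next
    fix e assume "e \<in> parcs (bicyclic3 p q r)"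
    then show "fst e \<noteq> snd e" by (rule loop)
  qed (use fin sym in \<open>simp_all add: bicyclic3_def\<close>)
qed

lemma bicyclic3_connected:
  assumes "p \<ge> 1" "q \<ge> 2" "r \<ge> 1"
  shows "connected (with_proj (bicyclic3 p q r))"
proof -
  define G where "G = bicyclic3 p q r"
  interpret pair_graph G
    unfolding G_def using assms by (rule bicyclic3_pair_graph)
  have vG: "i \<in> pverts G \<longleftrightarrow> 1 \<le> i \<and> i \<le> p + q + r" for i
    by (auto simp: G_def bicyclic3_def)
  have adj: "u \<rightarrow>\<^sup>*\<^bsub>with_proj G\<^esub> v" if "(u, v) \<in> bicyclic3_edges p q r \<union> (bicyclic3_edges p q r)\<inverse>" for u v
    using that by (intro reachable_adjI) (simp add: G_def bicyclic3_def)
  have start: "1 \<rightarrow>\<^sup>*\<^bsub>with_proj G\<^esub> i" if "1 \<le> i" "i \<le> p + q + r" for i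
    using that
  proof (induction i rule: nat_induct_at_least)
    case base
    then show ?case using vG[of 1] by (simp add: reachable_refl)
  next
    case (Suc i)
    consider "i = p" | "i = p + q" | "i \<noteq> p" "i \<noteq> p + q" by blast
    then show ?case
    proof cases
      case 1
      then show ?thesis using adj[of 1 "p + 1"] by (simp add: bicyclic3_edges_def)
    next
      case 2
      have "1 \<rightarrow>\<^sup>*\<^bsub>with_proj G\<^esub> (p + 1)" "(p + 1) \<rightarrow>\<^sup>*\<^bsub>with_proj G\<^esub> (p + q + 1)"
        by (rule adj; simp add: bicyclic3_edges_def)+
      with 2 show ?thesis by (metis reachable_trans Suc_eq_plus1)
    next
      case 3
      with Suc have "1 \<rightarrow>\<^sup>*\<^bsub>with_proj G\<^esub> i" "i \<rightarrow>\<^sup>*\<^bsub>with_proj G\<^esub> (Suc i)"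
        by (simp, intro adj, auto simp: bicyclic3_edges_def)
      then show ?thesis by (rule reachable_trans)
    qed
  qed
  have "strongly_connected (with_proj G)"
  proof (rule strongly_connectedI)
    show "verts (with_proj G) \<noteq> {}" using vG[of 1] assms by auto
    fix u v assume "u \<in> verts (with_proj G)" "v \<in> verts (with_proj G)"
    then have "1 \<rightarrow>\<^sup>*\<^bsub>with_proj G\<^esub> u" "1 \<rightarrow>\<^sup>*\<^bsub>with_proj G\<^esub> v"
      using start vG by auto
    then show "u \<rightarrow>\<^sup>*\<^bsub>with_proj G\<^esub> v"
      using symmetric_reachable[OF sym_arcs] reachable_trans by blast
  qed
  then have "connected (with_proj G)"
    unfolding connected_def strongly_connected_def
    by (auto intro: reachable_mk_symmetricI)
  then show ?thesis by (simp add: G_def)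
qed

end

theory Submission
  imports Defs
begin

text \<open>The two vertices of degree three, \<open>v\<^sub>p\<^sub>+\<^sub>1\<close> and \<open>v\<^sub>p\<^sub>+\<^sub>q\<close>, are called hubs. A geodesic between
  vertices of different paths runs through a hub, which gives a closed formula for all distances in
  terms of the distances to the hubs; the formula is piecewise linear, so that checking that a set
  is resolving becomes linear arithmetic.

  One vertex never resolves, since a hub and its three neighbours have only three possible
  distances to it. Two vertices resolve for \<open>q \<le> p\<close> (take \<open>v\<^sub>1\<close> and the vertex of index
  \<open>(p + q) div 2\<close>) and for \<open>q > p\<close> with \<open>q \<noteq> p + 2, p + 4\<close> (take \<open>v\<^sub>1\<close> and \<open>v\<^sub>p\<^sub>+\<^sub>2\<close>). For
  \<open>q = p + 2 + 2e\<close> with \<open>e \<le> 1\<close> every pair \<open>w\<close>, \<open>w'\<close> leaves two vertices unresolved: up to the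
  automorphisms swapping the outer paths and reversing all paths, these are two neighbours of a hub
  if \<open>w\<close>, \<open>w'\<close> are on a common path, and otherwise two vertices cutting one of the cycles through
  \<open>w\<close> or \<open>w'\<close> symmetrically.\<close>

section \<open>Distances and walks\<close>

lemma (in wf_digraph) awalk_imp_shorter_apath:
  assumes "awalk u p v"
  shows "\<exists>p'. apath u p' v \<and> length p' \<le> length p"
  using assms
proof (induction p rule: length_induct)
  case (1 p)
  show ?case
  proof (cases "distinct (awalk_verts u p)")
    case True
    with 1 show ?thesis by (auto simp: apath_def)
  next
    case False
    from awalk_not_distinct_decomp[OF 1(2) False]
    obtain q s t where "p = q @ s @ t" "s \<noteq> []" "\<exists>w. awalk u q w \<and> awalk w t v" by auto
    then have "length (q @ t) < length p" "awalk u (q @ t) v" by auto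
    with 1(1) show ?thesis by (meson less_imp_le order_trans)
  qed
qed

context pair_wf_digraph
begin

lemma relpow_imp_apath:
  assumes "(u, v) \<in> ((parcs G)\<^sup>=) ^^ n" "u \<in> pverts G"
  shows "\<exists>p. apath u p v \<and> length p \<le> n"
proof -
  have "\<exists>p. awalk u p v \<and> length p \<le> n"
    using assms
  proof (induction n arbitrary: u)
    case 0
    then show ?case by (auto simp: awalk_Nil_iff intro!: exI[of _ "[]"])
  next
    case (Suc n)
    from Suc.prems(1) obtain w where w: "(u, w) \<in> (parcs G)\<^sup>=" "(w, v) \<in> ((parcs G)\<^sup>=) ^^ n"
      by (meson relpow_Suc_E2)
    with Suc.prems(2) have "w \<in> pverts G" by (auto dest: in_arcsD2)
    with Suc.IH w(2) obtain p where p: "awalk w p v" "length p \<le> n" by blast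
    show ?case
    proof (cases "u = w")
      case True
      with p show ?thesis by auto
    next
      case False
      with w(1) have "(u, w) \<in> parcs G" by auto
      with p Suc.prems(2) have "awalk u ((u, w) # p) v" by (simp add: awalk_Cons_iff)
      with p(2) show ?thesis by (intro exI[of _ "(u, w) # p"]) simp
    qed
  qed
  then show ?thesis
    using awalk_imp_shorter_apath by (meson order_trans)
qed

lemma gdist_eqI:
  assumes reach: "\<And>u. u \<in> pverts G \<Longrightarrow> (u, w) \<in> ((parcs G)\<^sup>=) ^^ f u"
    and step: "\<And>u v. (u, v) \<in> parcs G \<Longrightarrow> f u \<le> f v + 1"
    and "f w = 0" "u \<in> pverts G"
  shows "gdist G u w = f u"
proof (rule antisym)
  obtain p where p: "apath u p w" "length p \<le> f u"
    using relpow_imp_apath reach assms(4) by blast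
  then show "gdist G u w \<le> f u"
    unfolding gdist_def by (auto intro: Least_le[THEN order_trans])
  have lower: "f u \<le> length p" if "awalk u p w" for u p
    using that
  proof (induction p arbitrary: u)
    case Nil
    then show ?case using assms(3) by (simp add: awalk_Nil_iff)
  next
    case (Cons e p)
    then have "e \<in> parcs G" "fst e = u" "f (snd e) \<le> length p" by (auto simp: awalk_Cons_iff)
    with step[of u "snd e"] show ?case by (cases e) auto
  qed
  have "\<exists>p'. apath u p' w \<and> length p' = gdist G u w"
    unfolding gdist_def by (rule LeastI_ex) (use p in blast)
  then show "f u \<le> gdist G u w" using lower awalkI_apath by metis
qed

end

section \<open>Distances in the graph\<close>

text \<open>The hubs are at distance \<open>hub_gap\<close> from each other, and \<open>v\<close> is at distance \<open>start_dist\<close> from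
  the hub \<open>p + 1\<close> and \<open>end_dist\<close> from the hub \<open>p + q\<close>.\<close>

definition hub_gap :: "nat \<Rightarrow> nat \<Rightarrow> nat \<Rightarrow> nat" where
  "hub_gap p q r = min (q - 1) (min (p + 1) (r + 1))"

definition start_dist :: "nat \<Rightarrow> nat \<Rightarrow> nat \<Rightarrow> nat \<Rightarrow> nat" where
  "start_dist p q r v =
     (if v \<le> p then min v (p + 1 - v + hub_gap p q r)
      else if v \<le> p + q then min (v - (p + 1)) (p + q - v + hub_gap p q r)
      else min (v - (p + q)) (p + q + r + 1 - v + hub_gap p q r))"

definition end_dist :: "nat \<Rightarrow> nat \<Rightarrow> nat \<Rightarrow> nat \<Rightarrow> nat" where
  "end_dist p q r v =
     (if v \<le> p then min (p + 1 - v) (v + hub_gap p q r)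
      else if v \<le> p + q then min (p + q - v) (v - (p + 1) + hub_gap p q r)
      else min (p + q + r + 1 - v) (v - (p + q) + hub_gap p q r))"

definition same_path :: "nat \<Rightarrow> nat \<Rightarrow> nat \<Rightarrow> nat \<Rightarrow> bool" where
  "same_path p q u v \<longleftrightarrow> (u \<le> p \<longleftrightarrow> v \<le> p) \<and> (u \<le> p + q \<longleftrightarrow> v \<le> p + q)"

definition bicyclic3_dist :: "nat \<Rightarrow> nat \<Rightarrow> nat \<Rightarrow> nat \<Rightarrow> nat \<Rightarrow> nat" where
  "bicyclic3_dist p q r u v =
     (let d = min (start_dist p q r u + start_dist p q r v) (end_dist p q r u + end_dist p q r v)
      in if same_path p q u v then min d (if u \<le> v then v - u else u - v) else d)"

lemma min_le_min_add:
  fixes a b c d k :: nat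
  shows "a \<le> c + k \<Longrightarrow> b \<le> d + k \<Longrightarrow> min a b \<le> min c d + k"
  by linarith

lemma mem_parcs_bicyclic3:
  "(u, v) \<in> parcs (bicyclic3 p q r) \<longleftrightarrow>
     (u, v) \<in> bicyclic3_edges p q r \<or> (v, u) \<in> bicyclic3_edges p q r"
  by (simp add: bicyclic3_def)

lemma hub_gap_le: "hub_gap p q r \<le> q - 1" "hub_gap p q r \<le> p + 1" "hub_gap p q r \<le> r + 1"
  by (simp_all add: hub_gap_def)

context
  fixes p q r :: nat
  assumes pqr: "p \<ge> 1" "q \<ge> 2" "r \<ge> 1"
begin

lemma edge_cases:
  assumes "(u, v) \<in> bicyclic3_edges p q r"
  obtains "v = u + 1" "same_path p q u v" "1 \<le> u" "v \<le> p + q + r"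
  | "u = 1" "v = p + 1" | "u = p + q + 1" "v = p + 1"
  | "u = p" "v = p + q" | "u = p + q + r" "v = p + q"
proof -
  have "v = u + 1 \<and> (1 \<le> u \<and> u < p \<or> p + 1 \<le> u \<and> u < p + q \<or> p + q + 1 \<le> u \<and> u < p + q + r)
    \<or> (u, v) \<in> {(1, p + 1), (p + q + 1, p + 1), (p, p + q), (p + q + r, p + q)}"
    using assms unfolding bicyclic3_edges_def by auto
  then consider "v = u + 1" "1 \<le> u" "u < p" | "v = u + 1" "p + 1 \<le> u" "u < p + q"
    | "v = u + 1" "p + q + 1 \<le> u" "u < p + q + r"
    | "(u, v) \<in> {(1, p + 1), (p + q + 1, p + 1), (p, p + q), (p + q + r, p + q)}" by blast
  then show thesis
  proof cases
    case 4
    then show thesis using that(2-5) by blast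
  qed (rule that(1); simp add: same_path_def)+
qed

lemma hub_dist:
  "start_dist p q r (p + 1) = 0" "end_dist p q r (p + q) = 0"
  "end_dist p q r (p + 1) = hub_gap p q r" "start_dist p q r (p + q) = hub_gap p q r"
  using pqr hub_gap_le[of p q r] by (simp_all add: start_dist_def end_dist_def)

lemma hub_edge_dist:
  assumes "(u, v) \<in> bicyclic3_edges p q r" "\<not> same_path p q u v"
  shows "start_dist p q r u + start_dist p q r v \<le> 1 \<or> end_dist p q r u + end_dist p q r v \<le> 1"
  using assms(1)
proof (cases rule: edge_cases)
  case 1
  then show ?thesis using assms(2) by simp
next
  case 2
  have "start_dist p q r 1 \<le> 1" using pqr by (simp add: start_dist_def)
  then show ?thesis unfolding 2 hub_dist by simp
next
  case 3
  have "start_dist p q r (p + q + 1) \<le> 1" using pqr by (simp add: start_dist_def)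
  then show ?thesis unfolding 3 hub_dist by simp
next
  case 4
  have "end_dist p q r p \<le> 1" using pqr by (simp add: end_dist_def)
  then show ?thesis unfolding 4 hub_dist by simp
next
  case 5
  have "end_dist p q r (p + q + r) \<le> 1" using pqr by (simp add: end_dist_def)
  then show ?thesis unfolding 5 hub_dist by simp
qed

lemma start_dist_edge:
  assumes "(u, v) \<in> bicyclic3_edges p q r"
  shows "start_dist p q r u \<le> start_dist p q r v + 1 \<and> start_dist p q r v \<le> start_dist p q r u + 1"
  using assms
proof (cases rule: edge_cases)
  case 1
  consider "v \<le> p" | "u > p" "v \<le> p + q" | "u > p + q" using 1 by (auto simp: same_path_def)
  then show ?thesis
    by cases (simp_all add: start_dist_def 1(1), (intro conjI min_le_min_add; linarith)+)
next
  case 2 then show ?thesis unfolding 2 hub_dist using pqr by (simp add: start_dist_def)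
next
  case 3 then show ?thesis unfolding 3 hub_dist using pqr by (simp add: start_dist_def)
next
  case 4 then show ?thesis unfolding 4 hub_dist using pqr hub_gap_le[of p q r] by (simp add: start_dist_def)
next
  case 5 then show ?thesis unfolding 5 hub_dist using pqr hub_gap_le[of p q r] by (simp add: start_dist_def)
qed

lemma end_dist_edge:
  assumes "(u, v) \<in> bicyclic3_edges p q r"
  shows "end_dist p q r u \<le> end_dist p q r v + 1 \<and> end_dist p q r v \<le> end_dist p q r u + 1"
  using assms
proof (cases rule: edge_cases)
  case 1
  consider "v \<le> p" | "u > p" "v \<le> p + q" | "u > p + q" using 1 by (auto simp: same_path_def)
  then show ?thesis
    by cases (simp_all add: end_dist_def 1(1), (intro conjI min_le_min_add; linarith)+)
next
  case 2 then show ?thesis unfolding 2 hub_dist using pqr hub_gap_le[of p q r] by (simp add: end_dist_def)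
next
  case 3 then show ?thesis unfolding 3 hub_dist using pqr hub_gap_le[of p q r] by (simp add: end_dist_def)
next
  case 4 then show ?thesis unfolding 4 hub_dist using pqr by (simp add: end_dist_def)
next
  case 5 then show ?thesis unfolding 5 hub_dist using pqr by (simp add: end_dist_def)
qed

lemma step_relpow:
  assumes "u \<le> v" "same_path p q u v" "1 \<le> u" "v \<le> p + q + r"
  shows "(u, v) \<in> ((parcs (bicyclic3 p q r))\<^sup>=) ^^ (v - u)"
  using assms
proof (induction v rule: dec_induct)
  case base
  then show ?case by simp
next
  case (step v)
  from step.prems(1) step.hyps have same: "same_path p q u v" and arc: "v < p \<or> p < v \<and> v < p + q \<or> p + q < v"
    unfolding same_path_def by linarith+
  have "(v, v + 1) \<in> bicyclic3_edges p q r"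
    using arc step.prems step.hyps unfolding bicyclic3_edges_def by auto
  then have "(v, Suc v) \<in> (parcs (bicyclic3 p q r))\<^sup>=" by (simp add: mem_parcs_bicyclic3)
  moreover have "(u, v) \<in> ((parcs (bicyclic3 p q r))\<^sup>=) ^^ (v - u)"
    using step.IH same step.prems step.hyps by linarith
  ultimately have "(u, Suc v) \<in> ((parcs (bicyclic3 p q r))\<^sup>=) ^^ (Suc (v - u))" by (rule relpow_Suc_I[rotated])
  then show ?case using step.hyps by (simp add: Suc_diff_le)
qed

lemma hub_dist_same_path:
  assumes "same_path p q u v"
  shows "start_dist p q r u \<le> start_dist p q r v + (if u \<le> v then v - u else u - v)"
    and "end_dist p q r u \<le> end_dist p q r v + (if u \<le> v then v - u else u - v)"
proof -
  consider "u \<le> p" "v \<le> p" | "u > p" "u \<le> p + q" "v > p" "v \<le> p + q" | "u > p + q" "v > p + q"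
    using assms unfolding same_path_def by linarith
  note c = this
  show "start_dist p q r u \<le> start_dist p q r v + (if u \<le> v then v - u else u - v)"
    using c by cases (simp_all only: start_dist_def, (simp, intro conjI impI min_le_min_add; linarith)+)
  show "end_dist p q r u \<le> end_dist p q r v + (if u \<le> v then v - u else u - v)"
    using c by cases (simp_all only: end_dist_def, (simp, intro conjI impI min_le_min_add; linarith)+)
qed

lemma bicyclic3_dist_edge:
  assumes "(u, v) \<in> parcs (bicyclic3 p q r)"
  shows "bicyclic3_dist p q r u w \<le> bicyclic3_dist p q r v w + 1"
proof -
  define d where "d x = min (start_dist p q r x + start_dist p q r w) (end_dist p q r x + end_dist p q r w)" for x
  have arc: "(u, v) \<in> bicyclic3_edges p q r \<or> (v, u) \<in> bicyclic3_edges p q r"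
    using assms by (simp add: mem_parcs_bicyclic3)
  have step: "d u \<le> d v + 1"
    using arc start_dist_edge end_dist_edge
    unfolding d_def by (intro min_le_min_add) (fastforce simp del: One_nat_def)+
  have same: "v = u + 1 \<or> u = v + 1" if "same_path p q u v"
    using arc that pqr by (auto elim!: edge_cases simp: same_path_def)
  have hub: "d u \<le> (if v \<le> w then w - v else v - w) + 1" if "same_path p q v w" "\<not> same_path p q u v"
  proof -
    have "start_dist p q r u + start_dist p q r v \<le> 1 \<or> end_dist p q r u + end_dist p q r v \<le> 1"
      using arc that(2) hub_edge_dist[of u v] hub_edge_dist[of v u]
      by (auto simp: same_path_def)
    moreover have "same_path p q w v" using that(1) by (auto simp: same_path_def)
    note hub_dist_same_path[OF this]
    ultimately show ?thesis unfolding d_def by (auto split: if_splits)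
  qed
  show ?thesis
    unfolding bicyclic3_dist_def Let_def d_def[symmetric]
    using step same hub by (auto simp: same_path_def split: if_splits)
qed

text \<open>A pair in the \<open>n\<close>-th power of the reflexive closure is at distance at most \<open>n\<close>.\<close>

abbreviation (input) "within1 \<equiv> (parcs (bicyclic3 p q r))\<^sup>="

lemma within_sym_imp: "(u, v) \<in> within1 ^^ n \<Longrightarrow> (v, u) \<in> within1 ^^ n"
proof (induction n arbitrary: u)
  case (Suc n)
  then obtain w where "(u, w) \<in> within1" "(w, v) \<in> within1 ^^ n" by (meson relpow_Suc_E2)
  moreover from this have "(w, u) \<in> within1" by (auto simp: bicyclic3_def)
  ultimately show ?case using Suc.IH by (blast intro: relpow_Suc_I)
qed simp

lemma within_sym: "(u, v) \<in> within1 ^^ n \<longleftrightarrow> (v, u) \<in> within1 ^^ n"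
  using within_sym_imp by blast

lemma within_add: "(u, v) \<in> within1 ^^ m \<Longrightarrow> (v, w) \<in> within1 ^^ n \<Longrightarrow> (u, w) \<in> within1 ^^ (m + n)"
  by (auto simp: relpow_add)

lemma within_min: "(u, v) \<in> within1 ^^ m \<Longrightarrow> (u, v) \<in> within1 ^^ n \<Longrightarrow> (u, v) \<in> within1 ^^ min m n"
  by (simp add: min_def)

lemma within_edge: "(u, v) \<in> bicyclic3_edges p q r \<Longrightarrow> (u, v) \<in> within1 ^^ 1"
  by (simp add: bicyclic3_def)

lemma within_along:
  assumes "same_path p q u v" "u \<in> {1..p + q + r}" "v \<in> {1..p + q + r}"
  shows "(u, v) \<in> within1 ^^ (if u \<le> v then v - u else u - v)"
proof (cases "u \<le> v")
  case True
  then show ?thesis using step_relpow[of u v] assms by simp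
next
  case False
  then show ?thesis using step_relpow[of v u] assms within_sym[of u v] by (simp add: same_path_def)
qed

lemma within_to_hubs:
  assumes "v \<in> {1..p + q + r}"
  shows "(v, p + 1) \<in> within1 ^^ (if v \<le> p then v else if v \<le> p + q then v - (p + 1) else v - (p + q))"
      (is "_ \<in> within1 ^^ ?a")
    and "(v, p + q) \<in> within1 ^^ (if v \<le> p then p + 1 - v else if v \<le> p + q then p + q - v else p + q + r + 1 - v)"
      (is "_ \<in> within1 ^^ ?b")
proof -
  consider "v \<le> p" | "v > p" "v \<le> p + q" | "v > p + q" by linarith
  then have "(v, p + 1) \<in> within1 ^^ ?a \<and> (v, p + q) \<in> within1 ^^ ?b"
  proof cases
    case 1
    have "(v, 1) \<in> within1 ^^ (v - 1)" "(v, p) \<in> within1 ^^ (p - v)"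
      using within_along[of v 1] within_along[of v p] 1 assms pqr by (auto simp: same_path_def split: if_splits)
    moreover have "(1, p + 1) \<in> within1 ^^ 1" "(p, p + q) \<in> within1 ^^ 1"
      by (rule within_edge; simp add: bicyclic3_edges_def)+
    ultimately have "(v, p + 1) \<in> within1 ^^ (v - 1 + 1)" "(v, p + q) \<in> within1 ^^ (p - v + 1)"
      by (blast intro: within_add)+
    moreover have "v - 1 + 1 = v" "p - v + 1 = p + 1 - v" using 1 assms by auto
    ultimately show ?thesis using 1 by (simp only: if_True simp_thms)
  next
    case 2
    then show ?thesis
      using within_along[of v "p + 1"] within_along[of v "p + q"] assms pqr
      by (auto simp: same_path_def split: if_splits)
  next
    case 3
    have "(v, p + q + 1) \<in> within1 ^^ (v - (p + q + 1))" "(v, p + q + r) \<in> within1 ^^ (p + q + r - v)"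
      using within_along[of v "p + q + 1"] within_along[of v "p + q + r"] 3 assms pqr
      by (auto simp: same_path_def split: if_splits)
    moreover have "(p + q + 1, p + 1) \<in> within1 ^^ 1" "(p + q + r, p + q) \<in> within1 ^^ 1"
      by (rule within_edge; simp add: bicyclic3_edges_def)+
    ultimately have "(v, p + 1) \<in> within1 ^^ (v - (p + q + 1) + 1)" "(v, p + q) \<in> within1 ^^ (p + q + r - v + 1)"
      by (blast intro: within_add)+
    moreover have "v - (p + q + 1) + 1 = v - (p + q)" "p + q + r - v + 1 = p + q + r + 1 - v"
      using 3 assms by auto
    moreover have "\<not> v \<le> p" "\<not> v \<le> p + q" using 3 by auto
    ultimately show ?thesis by (simp only: if_False simp_thms)
  qed
  then show "(v, p + 1) \<in> within1 ^^ ?a" "(v, p + q) \<in> within1 ^^ ?b" by blast+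
qed

lemma within_hub_gap: "(p + 1, p + q) \<in> within1 ^^ hub_gap p q r"
proof -
  have "(p + 1, p + q) \<in> within1 ^^ (q - 1)" using within_to_hubs(2)[of "p + 1"] pqr by simp
  moreover have "(p + 1, p + q) \<in> within1 ^^ (p + 1)"
    using within_add[OF within_edge within_to_hubs(2), of "p + 1" 1]
      within_add[OF iffD1[OF within_sym within_to_hubs(1)] within_to_hubs(2), of 1] pqr
    by simp
  moreover have "(p + 1, p + q) \<in> within1 ^^ (r + 1)"
    using within_add[OF iffD1[OF within_sym within_to_hubs(1)] within_to_hubs(2), of "p + q + 1"] pqr by simp
  ultimately show ?thesis unfolding hub_gap_def by (intro within_min)
qed

lemma within_start_end_dist:
  assumes "v \<in> {1..p + q + r}"
  shows "(v, p + 1) \<in> within1 ^^ start_dist p q r v" "(v, p + q) \<in> within1 ^^ end_dist p q r v"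
proof -
  note within_to_hubs[OF assms] within_add[OF within_to_hubs(1)[OF assms] within_hub_gap]
    within_add[OF within_to_hubs(2)[OF assms] iffD1[OF within_sym within_hub_gap]]
  then show "(v, p + 1) \<in> within1 ^^ start_dist p q r v" "(v, p + q) \<in> within1 ^^ end_dist p q r v"
    unfolding start_dist_def end_dist_def by (auto intro!: within_min split: if_splits)
qed

theorem gdist_bicyclic3:
  assumes "u \<in> {1..p + q + r}" "w \<in> {1..p + q + r}"
  shows "gdist (bicyclic3 p q r) u w = bicyclic3_dist p q r u w"
proof -
  interpret pair_graph "bicyclic3 p q r" using pqr by (rule bicyclic3_pair_graph)
  have verts: "pverts (bicyclic3 p q r) = {1..p + q + r}" by (simp add: bicyclic3_def)
  show ?thesis
  proof (rule gdist_eqI)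
    fix v assume "v \<in> pverts (bicyclic3 p q r)"
    then have v: "v \<in> {1..p + q + r}" by (simp add: verts)
    have w: "(p + 1, w) \<in> within1 ^^ start_dist p q r w" "(p + q, w) \<in> within1 ^^ end_dist p q r w"
      using within_start_end_dist[OF assms(2)] within_sym by blast+
    show "(v, w) \<in> within1 ^^ bicyclic3_dist p q r v w"
      unfolding bicyclic3_dist_def Let_def
      using within_add[OF within_start_end_dist(1)[OF v] w(1)] within_add[OF within_start_end_dist(2)[OF v] w(2)]
        within_along[OF _ v assms(2)]
      by (cases "same_path p q v w"; simp only: if_True if_False simp_thms; intro within_min)
  next
    show "bicyclic3_dist p q r w w = 0" by (simp add: bicyclic3_dist_def same_path_def)
  qed (use assms bicyclic3_dist_edge verts in auto)
qed

end

section \<open>Resolving sets\<close>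

lemma vertex_cases:
  assumes "v \<in> {1..p + q + r}"
  obtains "1 \<le> v" "v \<le> p" | "p < v" "v \<le> p + q" | "p + q < v" "v \<le> p + q + (r::nat)"
  using assms by force

lemma bicyclic3_dist_commute: "bicyclic3_dist p q r u v = bicyclic3_dist p q r v u"
  by (auto simp: bicyclic3_dist_def same_path_def Let_def add.commute)

lemma int_bicyclic3_dist:
  "int (bicyclic3_dist p q r u v) =
     (let d = min (int (start_dist p q r u) + int (start_dist p q r v))
                  (int (end_dist p q r u) + int (end_dist p q r v))
      in if same_path p q u v then min d \<bar>int u - int v\<bar> else d)"
  by (auto simp: bicyclic3_dist_def Let_def of_nat_diff)

context
  fixes p q :: nat
  assumes p: "p \<ge> 1" and q: "q \<ge> p + 1"
begin

lemma hub_gap_wide: "int (hub_gap p q p) = min (int q - 1) (int p + 1)"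
  using p q unfolding hub_gap_def by linarith

lemma hub_dist_path1:
  assumes "1 \<le> v" "v \<le> p"
  shows "int (start_dist p q p v) = v" "int (end_dist p q p v) = int p + 1 - v"
  using assms q hub_gap_wide by (simp_all add: start_dist_def end_dist_def of_nat_diff)

lemma hub_dist_path2:
  assumes "p < v" "v \<le> p + q"
  shows "int (start_dist p q p v) = min (int v - p - 1) (2 * int p + q + 1 - v)"
    "int (end_dist p q p v) = min (int p + q - v) v"
  using assms q hub_gap_wide by (simp_all add: start_dist_def end_dist_def of_nat_diff; linarith)+

lemma hub_dist_path3:
  assumes "p + q < v" "v \<le> p + q + p"
  shows "int (start_dist p q p v) = int v - p - q" "int (end_dist p q p v) = 2 * int p + q + 1 - v"
  using assms q hub_gap_wide by (simp_all add: start_dist_def end_dist_def of_nat_diff)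

text \<open>The suffix \<open>ij\<close> says that \<open>u\<close> is on the path \<open>P\<^sub>i\<close> and \<open>v\<close> on \<open>P\<^sub>j\<close>. All formulas are stated over the
  integers to avoid truncated subtraction.\<close>

lemma dist_wide_11:
  assumes "1 \<le> u" "u \<le> p" "1 \<le> v" "v \<le> p"
  shows "int (bicyclic3_dist p q p u v) = \<bar>int u - v\<bar>"
  using assms by (simp add: int_bicyclic3_dist same_path_def Let_def hub_dist_path1)

lemma dist_wide_12:
  assumes "1 \<le> u" "u \<le> p" "p < v" "v \<le> p + q"
  shows "int (bicyclic3_dist p q p u v) = min (int u + v - p - 1) (2 * int p + q + 1 - u - v)"
  using assms by (simp add: int_bicyclic3_dist same_path_def Let_def hub_dist_path1 hub_dist_path2)

lemma dist_wide_13: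
  assumes "1 \<le> u" "u \<le> p" "p + q < v" "v \<le> p + q + p"
  shows "int (bicyclic3_dist p q p u v) = min (int u + v - p - q) (3 * int p + q + 2 - u - v)"
  using assms by (simp add: int_bicyclic3_dist same_path_def Let_def hub_dist_path1 hub_dist_path3)

lemma dist_wide_22:
  assumes "p < u" "u \<le> p + q" "p < v" "v \<le> p + q"
  shows "int (bicyclic3_dist p q p u v) = min \<bar>int u - v\<bar> (int p + q - \<bar>int u - v\<bar>)"

proof -
  have "int (bicyclic3_dist p q p u v) = min \<bar>int u - v\<bar> (int p + q - \<bar>int u - v\<bar>)"
    if "u \<le> v" "p < u" "v \<le> p + q" for u v
  proof -
    have "\<bar>int u - int v\<bar> = int v - int u" using that by simp
    with that show ?thesis
      by (simp add: int_bicyclic3_dist same_path_def Let_def hub_dist_path2) linarith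
  qed
  from this[of u v] this[of v u] show ?thesis
    using assms bicyclic3_dist_commute[of p q p u v] by (cases "u \<le> v") (simp_all add: abs_minus_commute)
qed

lemma dist_wide_32:
  assumes "p + q < u" "u \<le> p + q + p" "p < v" "v \<le> p + q"
  shows "int (bicyclic3_dist p q p u v) = min (int u + v - 2 * p - q - 1) (3 * int p + 2 * q + 1 - u - v)"
  using assms by (simp add: int_bicyclic3_dist same_path_def Let_def hub_dist_path2 hub_dist_path3)

lemma dist_wide_33:
  assumes "p + q < u" "u \<le> p + q + p" "p + q < v" "v \<le> p + q + p"
  shows "int (bicyclic3_dist p q p u v) = \<bar>int u - v\<bar>"
  using assms by (simp add: int_bicyclic3_dist same_path_def Let_def hub_dist_path3)

lemma resolve_wide:
  assumes "u \<in> {1..p + q + p}" "v \<in> {1..p + q + p}"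
    "bicyclic3_dist p q p u 1 = bicyclic3_dist p q p v 1"
    "bicyclic3_dist p q p u (p + 2) = bicyclic3_dist p q p v (p + 2)"
    "q \<ge> p + 3" "q \<noteq> p + 4"
  shows "u = v"
proof -
  define d1 d2 where "d1 x = int (bicyclic3_dist p q p x 1)"
    and "d2 x = int (bicyclic3_dist p q p x (p + 2))" for x
  have coords: "x \<le> p \<and> d1 x = int x - 1 \<and> d2 x = int x + 1
      \<or> x = p + 1 \<and> d1 x = 1 \<and> d2 x = 1
      \<or> p + 2 \<le> x \<and> 2 * x \<le> 3 * p + q \<and> d1 x = int x - p \<and> d2 x = int x - p - 2
      \<or> 3 * p + q \<le> 2 * x \<and> 2 * x \<le> 3 * p + q + 4 \<and> x \<le> p + q \<and> (x \<le> 2 * p + 2 \<or> 2 * p + 3 \<le> x)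
        \<and> d1 x = 2 * int p + q - x \<and> d2 x = int x - p - 2
      \<or> 3 * p + q + 4 \<le> 2 * x \<and> x \<le> p + q \<and> d1 x = 2 * int p + q - x \<and> d2 x = 2 * int p + q + 2 - x
      \<or> p + q < x \<and> 2 * x \<le> 4 * p + 2 * q \<and> d1 x = int x - p - q + 1 \<and> d2 x = int x - p - q + 1
      \<or> 4 * p + 2 * q \<le> 2 * x \<and> x \<le> p + q + p \<and> d1 x = 3 * int p + q + 1 - x \<and> d2 x = int x - p - q + 1"
    if "x \<in> {1..p + q + p}" for x
    using that
  proof (cases rule: vertex_cases)
    case 1
    have "d1 x = \<bar>int x - 1\<bar>" "d2 x = min (int x + 1) (int p + q - 1 - x)"
      using 1 q p dist_wide_11[of x 1] dist_wide_12[of x "p + 2"]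
      by (simp_all add: d1_def d2_def algebra_simps)
    moreover from this 1 assms(5) have "d1 x = int x - 1" "d2 x = int x + 1" by linarith+
    ultimately show ?thesis using 1 by blast
  next
    case 2
    have "d1 x = min (int x - p) (2 * int p + q - x)"
      "d2 x = min \<bar>int x - p - 2\<bar> (int p + q - \<bar>int x - p - 2\<bar>)"
      using 2 q p dist_wide_12[of 1 x, unfolded bicyclic3_dist_commute[of p q p 1 x]]
        dist_wide_22[of x "p + 2"]
      by (simp_all add: d1_def d2_def algebra_simps)
    note d = this
    show ?thesis
    proof (cases "x = p + 1")
      case True
      with d assms(5) p have "d1 x = 1" "d2 x = 1" by simp_all
      with True show ?thesis by blast
    next
      case False
      then have "\<bar>int x - p - 2\<bar> = int x - p - 2" using 2 by simp
      with d have d': "d1 x = min (int x - p) (2 * int p + q - x)"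
        "d2 x = min (int x - p - 2) (2 * int p + q + 2 - x)" by simp_all
      have x: "p + 2 \<le> x" using 2 False by simp
      consider "2 * x \<le> 3 * p + q" | "3 * p + q \<le> 2 * x" "2 * x \<le> 3 * p + q + 4"
        | "3 * p + q + 4 \<le> 2 * x" by linarith
      then show ?thesis
      proof cases
        case 1
        with d' have "d1 x = int x - p" "d2 x = int x - p - 2" by linarith+
        with 1 x show ?thesis by blast
      next
        case middle: 2
        with d' have "d1 x = 2 * int p + q - x" "d2 x = int x - p - 2" by linarith+
        moreover have "x \<le> 2 * p + 2 \<or> 2 * p + 3 \<le> x" by linarith
        ultimately show ?thesis using middle 2 by blast
      next
        case 3
        with d' have "d1 x = 2 * int p + q - x" "d2 x = 2 * int p + q + 2 - x" by linarith+
        with 3 2 show ?thesis by blast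
      qed
    qed
  next
    case 3
    have "d1 x = min (int x - p - q + 1) (3 * int p + q + 1 - x)"
      "d2 x = min (int x - p - q + 1) (2 * int p + 2 * q - 1 - x)"
      using 3 q p dist_wide_13[of 1 x, unfolded bicyclic3_dist_commute[of p q p 1 x]]
        dist_wide_32[of x "p + 2"]
      by (simp_all add: d1_def d2_def algebra_simps)
    moreover from this 3 assms(5) have "d2 x = int x - p - q + 1" by linarith
    ultimately show ?thesis using 3 by (cases "2 * x \<le> 4 * p + 2 * q") (simp_all add: min_def)
  qed
  have eq: "d1 u = d1 v" "d2 u = d2 v" using assms by (simp_all add: d1_def d2_def)
  \<comment> \<open>If \<open>q = p + 3\<close>, one kind of collision is excluded only by parity, which linear arithmetic
    misses; hence the case distinction at \<open>2 * p + 2\<close> in \<open>coords\<close>.\<close>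
  have "q = p + 3 \<or> q \<ge> p + 5" using assms(5,6) by linarith
  then show ?thesis
    using coords[OF assms(1)] coords[OF assms(2)] eq p by (elim disjE conjE) linarith+
qed

lemma resolve_tight:
  assumes "u \<in> {1..p + q + p}" "v \<in> {1..p + q + p}"
    "bicyclic3_dist p q p u 1 = bicyclic3_dist p q p v 1"
    "bicyclic3_dist p q p u (p + 2) = bicyclic3_dist p q p v (p + 2)"
    "q = p + 1"
  shows "u = v"
proof -
  define d1 d2 where "d1 x = int (bicyclic3_dist p q p x 1)"
    and "d2 x = int (bicyclic3_dist p q p x (p + 2))" for x
  have coords: "x \<le> p \<and> d1 x = int x - 1 \<and> d2 x = min (int x + 1) (2 * int p - x)
      \<or> p + 1 \<le> x \<and> x \<le> p + q \<and> d1 x = min (int x - p) (3 * int p + 1 - x) \<and> d2 x = \<bar>int x - p - 2\<bar>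
      \<or> p + q < x \<and> x \<le> p + q + p \<and> d1 x = min (int x - p - q + 1) (4 * int p + 2 - x)
        \<and> d2 x = min (int x - p - q + 1) (4 * int p + 1 - x)"
    if "x \<in> {1..p + q + p}" for x
    using that
  proof (cases rule: vertex_cases)
    case 1
    have "d1 x = \<bar>int x - 1\<bar>" "d2 x = min (int x + 1) (int p + q - 1 - x)"
      using 1 q p dist_wide_11[of x 1] dist_wide_12[of x "p + 2"]
      by (simp_all add: d1_def d2_def algebra_simps)
    then show ?thesis using 1 assms(5) by simp
  next
    case 2
    have "d1 x = min (int x - p) (2 * int p + q - x)"
      "d2 x = min \<bar>int x - p - 2\<bar> (int p + q - \<bar>int x - p - 2\<bar>)"
      using 2 q p dist_wide_12[of 1 x, unfolded bicyclic3_dist_commute[of p q p 1 x]]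
        dist_wide_22[of x "p + 2"]
      by (simp_all add: d1_def d2_def algebra_simps)
    moreover have "\<bar>int x - p - 2\<bar> \<le> int p" using 2 assms(5) p by linarith
    moreover from this assms(5) have "int p + q - \<bar>int x - p - 2\<bar> \<ge> \<bar>int x - p - 2\<bar>" by linarith
    ultimately show ?thesis using 2 assms(5) by simp
  next
    case 3
    have "d1 x = min (int x - p - q + 1) (3 * int p + q + 1 - x)"
      "d2 x = min (int x - p - q + 1) (2 * int p + 2 * q - 1 - x)"
      using 3 q p dist_wide_13[of 1 x, unfolded bicyclic3_dist_commute[of p q p 1 x]]
        dist_wide_32[of x "p + 2"]
      by (simp_all add: d1_def d2_def algebra_simps)
    then show ?thesis using 3 assms(5) by simp
  qed
  have eq: "d1 u = d1 v" "d2 u = d2 v" using assms by (simp_all add: d1_def d2_def)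
  show ?thesis
    using coords[OF assms(1)] coords[OF assms(2)] eq p assms(5) by (elim disjE conjE) linarith+
qed

lemma resolve_wide_triple:
  assumes "u \<in> {1..p + q + p}" "v \<in> {1..p + q + p}"
    "bicyclic3_dist p q p u 1 = bicyclic3_dist p q p v 1"
    "bicyclic3_dist p q p u (p + 1) = bicyclic3_dist p q p v (p + 1)"
    "bicyclic3_dist p q p u (p + q + 1) = bicyclic3_dist p q p v (p + q + 1)"
  shows "u = v"
proof -
  define d1 d2 d3 where "d1 x = int (bicyclic3_dist p q p x 1)"
    and "d2 x = int (bicyclic3_dist p q p x (p + 1))"
    and "d3 x = int (bicyclic3_dist p q p x (p + q + 1))" for x
  have path1: "d1 x = int x - 1"
    "d2 x = x"
    "d3 x = min (int x + 1) (2 * int p + 1 - x)"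
    if "1 \<le> x" "x \<le> p" for x
    using that p q dist_wide_11[of x 1] dist_wide_12[of x "p + 1"] dist_wide_13[of x "p + q + 1"]
    by (simp_all add: d1_def d2_def d3_def algebra_simps)
  have path2: "d1 x = min (int x - p) (2 * int p + q - x)"
    "d2 x = min (int x - p - 1) (2 * int p + q + 1 - x)"
    "d3 x = min (int x - p) (2 * int p + q - x)"
    if "p < x" "x \<le> p + q" for x
    using that p q dist_wide_12[of 1 x, unfolded bicyclic3_dist_commute[of p q p 1 x]]
      dist_wide_22[of x "p + 1"]
      dist_wide_32[of "p + q + 1" x, unfolded bicyclic3_dist_commute[of p q p "p + q + 1" x]]
    by (simp_all add: d1_def d2_def d3_def algebra_simps)
  have path3: "d1 x = min (int x - p - q + 1) (3 * int p + q + 1 - x)"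
    "d2 x = int x - p - q"
    "d3 x = int x - p - q - 1"
    if "p + q < x" "x \<le> p + q + p" for x
    using that p q dist_wide_13[of 1 x, unfolded bicyclic3_dist_commute[of p q p 1 x]]
      dist_wide_32[of x "p + 1"] dist_wide_33[of x "p + q + 1"]
    by (simp_all add: d1_def d2_def d3_def algebra_simps)
  have coords: "1 \<le> x \<and> x \<le> p \<and> d1 x = int x - 1 \<and> d2 x = x
        \<and> d3 x = min (int x + 1) (2 * int p + 1 - x)
      \<or> p < x \<and> x \<le> p + q \<and> d1 x = min (int x - p) (2 * int p + q - x)
        \<and> d2 x = min (int x - p - 1) (2 * int p + q + 1 - x) \<and> d3 x = min (int x - p) (2 * int p + q - x)
      \<or> p + q < x \<and> x \<le> p + q + p \<and> d1 x = min (int x - p - q + 1) (3 * int p + q + 1 - x)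
        \<and> d2 x = int x - p - q \<and> d3 x = int x - p - q - 1"
    if "x \<in> {1..p + q + p}" for x
    by (rule vertex_cases[OF that]) (use path1[of x] path2[of x] path3[of x] in auto)
  have eq: "d1 u = d1 v"
    "d2 u = d2 v"
    "d3 u = d3 v"
    using assms by (simp_all add: d1_def d2_def d3_def)
  show ?thesis
    using coords[OF assms(1)] coords[OF assms(2)] eq q by (elim disjE conjE) linarith+
qed

end

context
  fixes p q t :: nat
  assumes q: "q \<ge> 2" and qp: "q \<le> p" and t: "t = (p + q) div 2"
begin

lemma t_bounds: "q \<le> t" "t \<le> p" "2 * t \<le> p + q" "p + q \<le> 2 * t + 1"
  using qp t by auto

lemma hub_gap_narrow: "int (hub_gap p q p) = int q - 1"
  using q qp unfolding hub_gap_def by linarith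

lemma hub_dist_narrow_1:
  assumes "1 \<le> v" "v \<le> p"
  shows "int (start_dist p q p v) = min (int v) (int p + q - v)"
    "int (end_dist p q p v) = min (int p + 1 - v) (int v + q - 1)"
  using assms hub_gap_narrow by (simp_all add: start_dist_def end_dist_def of_nat_diff)

lemma hub_dist_narrow_2:
  assumes "p < v" "v \<le> p + q"
  shows "int (start_dist p q p v) = int v - p - 1" "int (end_dist p q p v) = int p + q - v"
  using assms hub_gap_narrow by (simp_all add: start_dist_def end_dist_def of_nat_diff)

lemma hub_dist_narrow_3:
  assumes "p + q < v" "v \<le> p + q + p"
  shows "int (start_dist p q p v) = min (int v - p - q) (2 * int p + 2 * q - v)"
    "int (end_dist p q p v) = min (2 * int p + q + 1 - v) (int v - p - 1)"
  using assms hub_gap_narrow by (simp_all add: start_dist_def end_dist_def of_nat_diff)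

lemma hub_dist_narrow_wit:
  "int (start_dist p q p 1) = 1" "int (end_dist p q p 1) = q"
  "int (start_dist p q p t) = t" "int (end_dist p q p t) = int p + 1 - t"
  using hub_dist_narrow_1[of 1] hub_dist_narrow_1[of t] t_bounds q qp by simp_all

lemma dist_narrow_1:
  assumes "1 \<le> v" "v \<le> p"
  shows "int (bicyclic3_dist p q p v 1) = min (int v - 1) (int p + q + 1 - v)"
    "int (bicyclic3_dist p q p v t) = \<bar>int v - t\<bar>"
  using assms q qp t_bounds
  by (simp_all add: int_bicyclic3_dist same_path_def Let_def hub_dist_narrow_1[of v] hub_dist_narrow_wit
      del: One_nat_def)

lemma dist_narrow_2:
  assumes "p < v" "v \<le> p + q"
  shows "int (bicyclic3_dist p q p v 1) = int v - p"
    "int (bicyclic3_dist p q p v t) = min (int v + t - p - 1) (2 * int p + q + 1 - v - t)"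
  using assms q qp t_bounds
  by (simp_all add: int_bicyclic3_dist same_path_def Let_def hub_dist_narrow_2[of v] hub_dist_narrow_wit
      del: One_nat_def)

lemma dist_narrow_3:
  assumes "p + q < v" "v \<le> p + q + p"
  shows "int (bicyclic3_dist p q p v 1) = min (int v - p - q + 1) (2 * int p + 2 * q + 1 - v)"
    "int (bicyclic3_dist p q p v t) =
       min (min (int v - p - q) (2 * int p + 2 * q - v) + t)
           (min (2 * int p + q + 1 - v) (int v - p - 1) + p + 1 - t)"
  using assms q qp t_bounds
  by (simp_all add: int_bicyclic3_dist same_path_def Let_def hub_dist_narrow_3[of v] hub_dist_narrow_wit
      del: One_nat_def)

lemma resolve_narrow:
  assumes "u \<in> {1..p + q + p}" "v \<in> {1..p + q + p}"
    "bicyclic3_dist p q p u 1 = bicyclic3_dist p q p v 1"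
    "bicyclic3_dist p q p u t = bicyclic3_dist p q p v t"
  shows "u = v"
proof -
  define d1 dt where "d1 x = int (bicyclic3_dist p q p x 1)"
    and "dt x = int (bicyclic3_dist p q p x t)" for x
  have coords: "1 \<le> x \<and> x \<le> t \<and> d1 x = int x - 1 \<and> dt x = int t - x
      \<or> t < x \<and> x \<le> p \<and> d1 x = min (int x - 1) (int p + q + 1 - x) \<and> dt x = int x - t
      \<or> p < x \<and> x \<le> p + q \<and> d1 x = int x - p
        \<and> dt x = min (int x + t - p - 1) (2 * int p + q + 1 - x - t)
      \<or> p + q < x \<and> x \<le> p + q + t \<and> d1 x = int x - p - q + 1
        \<and> dt x = min (int x - p - q + t) (3 * int p + q + 2 - x - t)
      \<or> p + q + t < x \<and> x \<le> p + q + p \<and> d1 x = 2 * int p + 2 * q + 1 - x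
        \<and> dt x = 3 * int p + q + 2 - x - t"
    if "x \<in> {1..p + q + p}" for x
    using that
  proof (cases rule: vertex_cases)
    case 1
    note d = dist_narrow_1[OF 1, folded d1_def dt_def]
    show ?thesis
    proof (cases "x \<le> t")
      case True
      with d t_bounds have "d1 x = int x - 1" "dt x = int t - x" by linarith+
      with True 1 show ?thesis by blast
    next
      case False
      with d have "dt x = int x - t" by linarith
      with False 1 d show ?thesis by simp
    qed
  next
    case 2
    with dist_narrow_2[OF 2, folded d1_def dt_def] show ?thesis by blast
  next
    case 3
    note d = dist_narrow_3[OF 3, folded d1_def dt_def]
    show ?thesis
    proof (cases "x \<le> p + q + t")
      case True
      with d t_bounds have "d1 x = int x - p - q + 1" by linarith
      moreover from d True t_bounds 3 q have "dt x = min (int x - p - q + t) (3 * int p + q + 2 - x - t)" by linarith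
      ultimately show ?thesis using True 3 by blast
    next
      case False
      with d t_bounds 3 have "d1 x = 2 * int p + 2 * q + 1 - x" by linarith
      moreover from d False t_bounds 3 q have "dt x = 3 * int p + q + 2 - x - t" by linarith
      ultimately show ?thesis using False 3 by simp
    qed
  qed
  have eq: "d1 u = d1 v" "dt u = dt v" using assms by (simp_all add: d1_def dt_def)
  have "p + q = 2 * t \<or> p + q = 2 * t + 1" using t_bounds by linarith
  then show ?thesis
    using coords[OF assms(1)] coords[OF assms(2)] eq q qp by (elim disjE conjE) linarith+
qed

end

section \<open>Unresolved pairs\<close>

definition unresolved :: "nat \<Rightarrow> nat \<Rightarrow> nat \<Rightarrow> nat \<Rightarrow> bool" where
  "unresolved p q w w' \<longleftrightarrow>
     (\<exists>u\<in>{1..p + q + p}. \<exists>v\<in>{1..p + q + p}. u \<noteq> v \<and>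
        bicyclic3_dist p q p u w = bicyclic3_dist p q p v w \<and>
        bicyclic3_dist p q p u w' = bicyclic3_dist p q p v w')"

lemma unresolvedI:
  assumes "u \<in> {1..p + q + p}" "v \<in> {1..p + q + p}" "u \<noteq> v"
    "int (bicyclic3_dist p q p u w) = int (bicyclic3_dist p q p v w)"
    "int (bicyclic3_dist p q p u w') = int (bicyclic3_dist p q p v w')"
  shows "unresolved p q w w'"
  unfolding unresolved_def
  by (rule bexI[OF _ assms(1)], rule bexI[OF _ assms(2)]) (use assms(3-5) in simp)

lemma unresolved_commute: "unresolved p q w w' \<longleftrightarrow> unresolved p q w' w"
  unfolding unresolved_def by blast

lemma unresolved_automorphism:
  assumes phi: "\<And>v. v \<in> {1..p + q + p} \<Longrightarrow> \<phi> v \<in> {1..p + q + p} \<and> \<phi> (\<phi> v) = v"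
    and dist: "\<And>u v. u \<in> {1..p + q + p} \<Longrightarrow> v \<in> {1..p + q + p} \<Longrightarrow>
      bicyclic3_dist p q p (\<phi> u) (\<phi> v) = bicyclic3_dist p q p u v"
    and w: "w \<in> {1..p + q + p}" "w' \<in> {1..p + q + p}"
    and "unresolved p q (\<phi> w) (\<phi> w')"
  shows "unresolved p q w w'"
proof -
  from assms(5) obtain u v where uv: "u \<in> {1..p + q + p}" "v \<in> {1..p + q + p}" "u \<noteq> v"
    "bicyclic3_dist p q p u (\<phi> w) = bicyclic3_dist p q p v (\<phi> w)"
    "bicyclic3_dist p q p u (\<phi> w') = bicyclic3_dist p q p v (\<phi> w')"
    unfolding unresolved_def by blast
  have move: "bicyclic3_dist p q p (\<phi> x) y = bicyclic3_dist p q p x (\<phi> y)"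
    if "x \<in> {1..p + q + p}" "y \<in> {1..p + q + p}" for x y
    using dist[of x "\<phi> y"] phi that by simp
  have "\<phi> u \<noteq> \<phi> v" using uv(1-3) phi by metis
  then show ?thesis
    using uv(4,5) phi[OF uv(1)] phi[OF uv(2)] move[OF uv(1)] move[OF uv(2)] w
    by (intro unresolvedI[of "\<phi> u" p q "\<phi> v"]) simp_all
qed

definition swap :: "nat \<Rightarrow> nat \<Rightarrow> nat \<Rightarrow> nat" where
  "swap p q v = (if v \<le> p then p + q + v else if v \<le> p + q then v else v - (p + q))"

definition reflect :: "nat \<Rightarrow> nat \<Rightarrow> nat \<Rightarrow> nat" where
  "reflect p q v =
     (if v \<le> p then p + 1 - v else if v \<le> p + q then p + q + p + 1 - v
      else p + q + (p + q + p) + 1 - v)"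

lemma hub_dist_swap:
  assumes "v \<in> {1..p + q + p}"
  shows "start_dist p q p (swap p q v) = start_dist p q p v"
    "end_dist p q p (swap p q v) = end_dist p q p v"
  using assms by (cases rule: vertex_cases; simp add: start_dist_def end_dist_def swap_def add.commute)+

lemma hub_dist_reflect:
  assumes "v \<in> {1..p + q + p}"
  shows "start_dist p q p (reflect p q v) = end_dist p q p v"
    "end_dist p q p (reflect p q v) = start_dist p q p v"
proof -
  have "start_dist p q p (reflect p q v) = end_dist p q p v \<and> end_dist p q p (reflect p q v) = start_dist p q p v"
    using assms
  proof (cases rule: vertex_cases)
    case 1
    then show ?thesis by (simp add: start_dist_def end_dist_def reflect_def)
  next
    case 2
    then have "p < p + q + p + 1 - v" "p + q + p + 1 - v \<le> p + q" by linarith+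
    with 2 show ?thesis by (simp add: start_dist_def end_dist_def reflect_def min.commute)
  next
    case 3
    then have "p + q < p + q + (p + q + p) + 1 - v" by linarith
    with 3 show ?thesis by (simp add: start_dist_def end_dist_def reflect_def ac_simps)
  qed
  then show "start_dist p q p (reflect p q v) = end_dist p q p v"
    "end_dist p q p (reflect p q v) = start_dist p q p v" by blast+
qed

lemma swap_path:
  assumes "v \<in> {1..p + q + p}"
  shows "swap p q v \<in> {1..p + q + p}" "swap p q (swap p q v) = v"
  using assms by (cases rule: vertex_cases; simp add: swap_def; linarith)+

lemma dist_swap:
  assumes "u \<in> {1..p + q + p}" "v \<in> {1..p + q + p}"
  shows "bicyclic3_dist p q p (swap p q u) (swap p q v) = bicyclic3_dist p q p u v"
proof -
  have "same_path p q (swap p q u) (swap p q v) \<longleftrightarrow> same_path p q u v"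
    using assms by (auto simp: same_path_def swap_def)
  moreover have "\<bar>int (swap p q u) - int (swap p q v)\<bar> = \<bar>int u - int v\<bar>" if "same_path p q u v"
    using that assms by (auto simp: same_path_def swap_def)
  ultimately have "int (bicyclic3_dist p q p (swap p q u) (swap p q v)) = int (bicyclic3_dist p q p u v)"
    using assms by (simp add: int_bicyclic3_dist hub_dist_swap Let_def)
  then show ?thesis by simp
qed

lemma reflect_path:
  assumes "v \<in> {1..p + q + p}"
  shows "reflect p q v \<le> p \<longleftrightarrow> v \<le> p" "reflect p q v \<le> p + q \<longleftrightarrow> v \<le> p + q"
    "reflect p q v \<in> {1..p + q + p}" "reflect p q (reflect p q v) = v"
proof -
  have "(reflect p q v \<le> p \<longleftrightarrow> v \<le> p) \<and> (reflect p q v \<le> p + q \<longleftrightarrow> v \<le> p + q) \<and>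
      reflect p q v \<in> {1..p + q + p} \<and> reflect p q (reflect p q v) = v"
    using assms
  proof (cases rule: vertex_cases)
    case 1
    then have "p + 1 - v \<le> p" "1 \<le> p + 1 - v" by linarith+
    with 1 show ?thesis by (simp add: reflect_def)
  next
    case 2
    then have "p < p + q + p + 1 - v" "p + q + p + 1 - v \<le> p + q" by linarith+
    with 2 show ?thesis by (simp add: reflect_def)
  next
    case 3
    then have "p + q < p + q + (p + q + p) + 1 - v" by linarith
    with 3 show ?thesis by (simp add: reflect_def)
  qed
  then show "reflect p q v \<le> p \<longleftrightarrow> v \<le> p" "reflect p q v \<le> p + q \<longleftrightarrow> v \<le> p + q"
    "reflect p q v \<in> {1..p + q + p}" "reflect p q (reflect p q v) = v"
    by blast+
qed

lemma dist_reflect: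
  assumes "u \<in> {1..p + q + p}" "v \<in> {1..p + q + p}"
  shows "bicyclic3_dist p q p (reflect p q u) (reflect p q v) = bicyclic3_dist p q p u v"
proof -
  have "same_path p q (reflect p q u) (reflect p q v) \<longleftrightarrow> same_path p q u v"
    using reflect_path[OF assms(1)] reflect_path[OF assms(2)] by (simp add: same_path_def)
  moreover have "\<bar>int (reflect p q u) - int (reflect p q v)\<bar> = \<bar>int u - int v\<bar>" if "same_path p q u v"
  proof -
    consider "u \<le> p" "v \<le> p" | "p < u" "u \<le> p + q" "p < v" "v \<le> p + q" | "p + q < u" "p + q < v"
      using \<open>same_path p q u v\<close> unfolding same_path_def by linarith
    then show ?thesis using assms by cases (simp_all add: reflect_def of_nat_diff)
  qed
  ultimately have "int (bicyclic3_dist p q p (reflect p q u) (reflect p q v)) = int (bicyclic3_dist p q p u v)"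
    using assms by (simp add: int_bicyclic3_dist hub_dist_reflect min.commute Let_def)
  then show ?thesis by simp
qed

lemma unresolved_swap:
  assumes "w \<in> {1..p + q + p}" "w' \<in> {1..p + q + p}" "unresolved p q (swap p q w) (swap p q w')"
  shows "unresolved p q w w'"
  by (rule unresolved_automorphism[where \<phi> = "swap p q"])
    (simp_all only: swap_path dist_swap assms simp_thms)

lemma unresolved_reflect:
  assumes "w \<in> {1..p + q + p}" "w' \<in> {1..p + q + p}" "unresolved p q (reflect p q w) (reflect p q w')"
  shows "unresolved p q w w'"
  by (rule unresolved_automorphism[where \<phi> = "reflect p q"])
    (simp_all only: reflect_path dist_reflect assms simp_thms)

context
  fixes p q :: nat
  assumes p: "p \<ge> 1" and q: "q \<ge> p + 1"
begin

lemma unresolved_path2: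
  assumes "p < w" "w \<le> p + q" "p < w'" "w' \<le> p + q"
  shows "unresolved p q w w'"
proof (rule unresolvedI[of 1 _ _ "p + q + 1"])
  have "int (bicyclic3_dist p q p 1 x) = int (bicyclic3_dist p q p (p + q + 1) x)" if "p < x" "x \<le> p + q" for x
    using that p dist_wide_12[OF p q, of 1 x] dist_wide_32[OF p q, of "p + q + 1" x] by simp
  then show "int (bicyclic3_dist p q p 1 w) = int (bicyclic3_dist p q p (p + q + 1) w)"
    "int (bicyclic3_dist p q p 1 w') = int (bicyclic3_dist p q p (p + q + 1) w')"
    using assms by blast+
qed (use p in auto)

lemma unresolved_path1:
  assumes "q \<ge> p + 2" "1 \<le> w" "w \<le> p + 1" "1 \<le> w'" "w' \<le> p + 1"
  shows "unresolved p q w w'"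
proof (rule unresolvedI[of "p + 2" _ _ "p + q + 1"])
  have "int (bicyclic3_dist p q p (p + 2) x) = int (bicyclic3_dist p q p (p + q + 1) x)"
    if x: "1 \<le> x" "x \<le> p + 1" for x
  proof (cases "x = p + 1")
    case True
    with x assms(1) p show ?thesis
      using dist_wide_22[OF p q, of "p + 2" "p + 1"] dist_wide_32[OF p q, of "p + q + 1" "p + 1"] by simp
  next
    case False
    with x have x: "1 \<le> x" "x \<le> p" by simp_all
    have "int (bicyclic3_dist p q p x (p + 2)) = min (int x + 1) (int p + q - 1 - x)"
      using x assms(1) dist_wide_12[OF p q, of x "p + 2"] by (simp add: algebra_simps)
    moreover have "int (bicyclic3_dist p q p x (p + q + 1)) = min (int x + 1) (2 * int p + 1 - x)"
      using x p dist_wide_13[OF p q, of x "p + q + 1"] by (simp add: algebra_simps)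
    ultimately show ?thesis
      unfolding bicyclic3_dist_commute[of p q p _ x] using x assms(1) by linarith
  qed
  then show "int (bicyclic3_dist p q p (p + 2) w) = int (bicyclic3_dist p q p (p + q + 1) w)"
    "int (bicyclic3_dist p q p (p + 2) w') = int (bicyclic3_dist p q p (p + q + 1) w')"
    using assms by blast+
qed (use p assms in auto)

text \<open>Counting positions from the hub \<open>p + 1\<close>, let \<open>w\<close> and \<open>w'\<close> have positions \<open>i\<close> and \<open>j\<close>. The first
  vertex is at position \<open>k = p + 1 + e - i - j\<close> of the third path. The second one is the vertex other
  than it at distances \<open>i + k\<close> and \<open>j + k\<close>: it solves \<open>m - j = j + k\<close> on the path of \<open>w'\<close> or
  \<open>m - i = i + k\<close> on the path of \<open>w\<close>, depending on which of the two has room.\<close>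

lemma unresolved_path12:
  assumes e: "q = p + 2 + 2 * e" "e \<le> 1"
    and w: "1 \<le> w" "w \<le> p" "p + 2 \<le> w'" "w' < p + q" "2 * (w + w') \<le> 3 * p + q + 2"
  shows "unresolved p q w w'"
proof -
  define j where "j = w' - (p + 1)"
  have j: "w' = p + 1 + j" "1 \<le> j" "w + j \<le> p + 1 + e" using w e by (simp_all add: j_def)
  define k where "k = p + 1 + e - w - j"
  have k: "k + w + j = p + 1 + e" "k \<le> p" using j w e by (simp_all add: k_def)
  define u where "u = (if k = 0 then p + 1 else p + q + k)"
  have u: "u \<in> {1..p + q + p}" "p < u" using k(2) p q by (simp_all add: u_def)
  have du: "int (bicyclic3_dist p q p u w) = int w + k" "int (bicyclic3_dist p q p u w') = int k + j"
  proof -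
    have "int (bicyclic3_dist p q p u w) = min (int w + k) (2 * int p + 2 - w - k)"
      using dist_wide_12[OF p q, of w "p + 1"] dist_wide_13[OF p q, of w "p + q + k"] w(1,2) k(2) q
      unfolding bicyclic3_dist_commute[of p q p u w] by (simp add: u_def algebra_simps)
    then show "int (bicyclic3_dist p q p u w) = int w + k" using k e j by linarith
    have "int (bicyclic3_dist p q p u w') = min (int k + j) (int p + q - k - j)"
      using dist_wide_22[OF p q, of "p + 1" w'] dist_wide_32[OF p q, of "p + q + k" w'] j(1) w(4) k(2) q
      by (simp add: u_def algebra_simps)
    then show "int (bicyclic3_dist p q p u w') = int k + j" using k e j w by linarith
  qed
  show ?thesis
  proof (cases "j \<le> w + e")
    case True
    define m where "m = p + 1 + e + j - w"
    have m: "m + w = p + 1 + e + j" "m \<le> q - 1" using True w e by (simp_all add: m_def)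
    have v: "p < p + 1 + m" "p + 1 + m \<le> p + q" using m e by simp_all
    have "int (bicyclic3_dist p q p (p + 1 + m) w) = min (int w + m) (int p + q - w - m)"
      using dist_wide_12[OF p q w(1,2) v]
      unfolding bicyclic3_dist_commute[of p q p _ w] by (simp add: algebra_simps)
    moreover have "int (bicyclic3_dist p q p (p + 1 + m) w') = min (int m - j) (int p + q - (int m - j))"
      using dist_wide_22[OF p q v, of w'] w j m e k by (simp add: algebra_simps)
    ultimately have "int (bicyclic3_dist p q p (p + 1 + m) w) = int w + k"
      "int (bicyclic3_dist p q p (p + 1 + m) w') = int k + j"
      using m k e j w by linarith+
    moreover have "u \<noteq> p + 1 + m" using m k j w e by (simp add: u_def)
    ultimately show ?thesis using du u v by (intro unresolvedI[of u _ _ "p + 1 + m"]) simp_all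
  next
    case False
    define m where "m = p + 1 + e + w - j"
    have m: "m + j = p + 1 + e + w" "1 \<le> m" "m \<le> p" using False w e j by (simp_all add: m_def)
    have "int (bicyclic3_dist p q p m w) = \<bar>int m - w\<bar>"
      using dist_wide_11[OF p q m(2,3) w(1,2)] .
    moreover have "int (bicyclic3_dist p q p m w') = min (int m + j) (int p + q - m - j)"
      using dist_wide_12[OF p q m(2,3), of w'] w j by (simp add: algebra_simps)
    ultimately have "int (bicyclic3_dist p q p m w) = int w + k" "int (bicyclic3_dist p q p m w') = int k + j"
      using m k e j w by linarith+
    moreover have "u \<noteq> m" using m u by simp
    ultimately show ?thesis using du u m by (intro unresolvedI[of u _ _ m]) simp_all
  qed
qed

lemma unresolved_path13:
  assumes "q \<ge> p + 2" "1 \<le> w" "w \<le> j" "j \<le> p" "w + j \<le> p + 1"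
  shows "unresolved p q w (p + q + j)"
proof -
  define k where "k = p + 1 - w - j"
  have k: "k + w + j = p + 1" using assms by (simp add: k_def)
  have u: "p < p + 1 + k" "p + 1 + k \<le> p + q" "w \<le> p" "p + q < p + q + j" "p + q + j \<le> p + q + p"
    using k assms by simp_all
  have "int (bicyclic3_dist p q p (p + 1 + k) w) = min (int w + k) (int p + q - w - k)"
    using dist_wide_12[OF p q assms(2) u(3,1,2)]
      unfolding bicyclic3_dist_commute[of p q p _ w] by (simp add: algebra_simps)
  moreover have "int (bicyclic3_dist p q p (p + 1 + k) (p + q + j)) = min (int j + k) (int p + q - j - k)"
    using dist_wide_32[OF p q u(4,5,1,2)] unfolding bicyclic3_dist_commute[of p q p _ "p + q + j"]
    by (simp add: algebra_simps)
  ultimately have du: "int (bicyclic3_dist p q p (p + 1 + k) w) = int w + k"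
    "int (bicyclic3_dist p q p (p + 1 + k) (p + q + j)) = int j + k"
    using k assms by linarith+
  define m where "m = p + 1 + w - j"
  have m: "m + j = p + 1 + w" using assms by (simp add: m_def)
  define v where "v = (if m = p + 1 then p + q else m)"
  have v: "v \<in> {1..p + q + p}" using m assms by (auto simp: v_def)
  have "int (bicyclic3_dist p q p v w) = int w + k"
  proof (cases "m = p + 1")
    case True
    have "int (bicyclic3_dist p q p v w) = min (int w + q - 1) (int p + 1 - w)"
      using True dist_wide_12[OF p q assms(2) u(3), of "p + q"] q unfolding bicyclic3_dist_commute[of p q p _ w]
      by (simp add: v_def algebra_simps)
    then show ?thesis using True m k assms by linarith
  next
    case False
    then show ?thesis using dist_wide_11[OF p q _ _ assms(2) u(3), of m] m k assms by (simp add: v_def)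
  qed
  moreover have "int (bicyclic3_dist p q p v (p + q + j)) = int j + k"
  proof (cases "m = p + 1")
    case True
    have "int (bicyclic3_dist p q p v (p + q + j)) = min (int j + q - 1) (int p + 1 - j)"
      using True dist_wide_32[OF p q u(4,5), of "p + q"] q unfolding bicyclic3_dist_commute[of p q p _ "p + q + j"]
      by (simp add: v_def algebra_simps)
    then show ?thesis using True m k assms by linarith
  next
    case False
    then have "int (bicyclic3_dist p q p v (p + q + j)) = min (int m + j) (2 * int p + 2 - m - j)"
      using dist_wide_13[OF p q _ _ u(4,5), of m] m assms by (simp add: v_def algebra_simps)
    then show ?thesis using m k assms by linarith
  qed
  moreover have "p + 1 + k \<noteq> v" using m k assms q by (auto simp: v_def)
  ultimately show ?thesis using du u v by (intro unresolvedI[of "p + 1 + k" _ _ v]) simp_all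
qed

end

lemma unresolved_path12_all:
  assumes e: "q = p + 2 + 2 * e" "e \<le> 1" and p: "p \<ge> 1"
    and w: "1 \<le> w" "w \<le> p" "p < w'" "w' \<le> p + q"
  shows "unresolved p q w w'"
proof -
  have q: "q \<ge> p + 1" "q \<ge> p + 2" using e by simp_all
  have V: "w \<in> {1..p + q + p}" "w' \<in> {1..p + q + p}" using w by simp_all
  have r: "reflect p q w = p + 1 - w" "reflect p q w' = p + q + p + 1 - w'"
    using w by (simp_all add: reflect_def)
  consider "w' = p + 1" | "w' = p + q" | "p + 2 \<le> w'" "w' < p + q" "2 * (w + w') \<le> 3 * p + q + 2"
    | "p + 2 \<le> w'" "w' < p + q" "2 * (w + w') \<ge> 3 * p + q + 2"
    using w by linarith
  then show ?thesis
  proof cases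
    case 1
    then show ?thesis using unresolved_path1[OF p q] w by simp
  next
    case 2
    have "unresolved p q (p + 1 - w) (p + 1)"
      using w by (intro unresolved_path1[OF p q]) simp_all
    then show ?thesis using 2 r by (intro unresolved_reflect[OF V]) simp
  next
    case 3
    then show ?thesis using unresolved_path12[OF p q(1) e] w by simp
  next
    case 4
    have "unresolved p q (p + 1 - w) (p + q + p + 1 - w')"
      using w 4 by (intro unresolved_path12[OF p q(1) e]) simp_all
    then show ?thesis using r by (intro unresolved_reflect[OF V]) simp
  qed
qed

lemma unresolved_path13_all:
  assumes p: "p \<ge> 1" and q: "q \<ge> p + 2"
    and w: "1 \<le> w" "w \<le> p" "p + q < w'" "w' \<le> p + q + p"
  shows "unresolved p q w w'"
proof -
  have q1: "q \<ge> p + 1" using q by simp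
  have low: "unresolved p q v (p + q + j)"
    if v: "1 \<le> v" "v \<le> p" "1 \<le> j" "j \<le> p" "v + j \<le> p + 1" for v j
  proof (cases "v \<le> j")
    case True
    then show ?thesis using unresolved_path13[OF p q1 q] v by simp
  next
    case False
    then have "unresolved p q j (p + q + v)"
      using v by (intro unresolved_path13[OF p q1 q]) simp_all
    then have "unresolved p q (swap p q v) (swap p q (p + q + j))"
      using v by (simp add: swap_def unresolved_commute)
    then show ?thesis
      using v by (intro unresolved_swap[of v p q "p + q + j"]) simp_all
  qed
  define j where "j = w' - (p + q)"
  have j: "w' = p + q + j" "1 \<le> j" "j \<le> p" using w by (simp_all add: j_def)
  show ?thesis
  proof (cases "w + j \<le> p + 1")
    case True
    then show ?thesis using low[of w j] w j by simp
  next
    case False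
    have "unresolved p q (p + 1 - w) (p + q + (p + 1 - j))"
      using False w j by (intro low) simp_all
    moreover have "p + q + (p + q + p) + 1 - w' = p + q + (p + 1 - j)" using j by simp
    ultimately have "unresolved p q (reflect p q w) (reflect p q w')"
      using w by (simp add: reflect_def)
    then show ?thesis
      using w by (intro unresolved_reflect[of w p q w']) simp_all
  qed
qed

lemma unresolved_all:
  assumes e: "q = p + 2 + 2 * e" "e \<le> 1" and p: "p \<ge> 1"
    and V: "w \<in> {1..p + q + p}" "w' \<in> {1..p + q + p}"
  shows "unresolved p q w w'"
proof -
  have q: "q \<ge> p + 1" "q \<ge> p + 2" using e by simp_all
  have from1: "unresolved p q x y" if x: "1 \<le> x" "x \<le> p" and y: "y \<in> {1..p + q + p}" for x y
    using y
  proof (cases rule: vertex_cases)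
    case 1
    then show ?thesis using unresolved_path1[OF p q] x by simp
  next
    case 2
    then show ?thesis using unresolved_path12_all[OF e p x] by simp
  next
    case 3
    then show ?thesis using unresolved_path13_all[OF p q(2) x] by simp
  qed
  have from3: "unresolved p q x y"
    if x: "p + q < x" "x \<le> p + q + p" and y: "y \<in> {1..p + q + p}" for x y
  proof (rule unresolved_swap)
    have "swap p q x = x - (p + q)" using x by (simp add: swap_def)
    then show "unresolved p q (swap p q x) (swap p q y)"
      using x by (intro from1 swap_path(1)[OF y]) simp_all
  qed (use x y in auto)
  show ?thesis
    using V(1)
  proof (cases rule: vertex_cases)
    case 1
    then show ?thesis using from1 V(2) by blast
  next
    case 3
    then show ?thesis using from3 V(2) by blast
  next
    case 2
    note path2 = this
    show ?thesis
      using V(2)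
    proof (cases rule: vertex_cases)
      case 1
      then show ?thesis using from1[of w' w] V(1) unresolved_commute by blast
    next
      case 2
      then show ?thesis using unresolved_path2[OF p q(1)] path2 by blast
    next
      case 3
      then show ?thesis using from3[of w' w] V(1) unresolved_commute by blast
    qed
  qed
qed

lemma unresolved_single:
  assumes p: "p \<ge> 1" and q: "q \<ge> 2"
  shows "unresolved p q w w"
proof -
  let ?d = "\<lambda>v. bicyclic3_dist p q p v w"
  have "(1, p + 1) \<in> bicyclic3_edges p q p" "(p + 1, p + 2) \<in> bicyclic3_edges p q p"
    "(p + q + 1, p + 1) \<in> bicyclic3_edges p q p"
    using q by (simp_all add: bicyclic3_edges_def)
  then have "?d v \<le> ?d (p + 1) + 1 \<and> ?d (p + 1) \<le> ?d v + 1" if "v \<in> {1, p + 2, p + q + 1}" for v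
    using that bicyclic3_dist_edge[OF p q p, of v "p + 1"] bicyclic3_dist_edge[OF p q p, of "p + 1" v]
    by (auto simp: mem_parcs_bicyclic3)
  from this[of 1] this[of "p + 2"] this[of "p + q + 1"]
  have "?d 1 = ?d (p + 1) \<or> ?d (p + 1) = ?d (p + 2) \<or> ?d (p + 1) = ?d (p + q + 1)
      \<or> ?d 1 = ?d (p + 2) \<or> ?d 1 = ?d (p + q + 1) \<or> ?d (p + 2) = ?d (p + q + 1)"
    by simp linarith
  moreover have "1 \<noteq> p + 1" "p + 1 \<noteq> p + 2" "p + 1 \<noteq> p + q + 1" "1 \<noteq> p + 2" "1 \<noteq> p + q + 1" "p + 2 \<noteq> p + q + 1"
    using p q by simp_all
  ultimately obtain u v where "u \<in> {1, p + 1, p + 2, p + q + 1}" "v \<in> {1, p + 1, p + 2, p + q + 1}"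
    "u \<noteq> v" "?d u = ?d v"
    by blast
  moreover have "{1, p + 1, p + 2, p + q + 1} \<subseteq> {1..p + q + p}" using p q by simp
  ultimately show ?thesis by (intro unresolvedI[of u _ _ v]) (blast, blast, simp_all only: simp_thms)
qed

section \<open>The metric dimension\<close>

lemma resolving_set_bicyclic3_iff:
  assumes p: "p \<ge> 1" and q: "q \<ge> 2"
  shows "resolving_set (bicyclic3 p q p) ws \<longleftrightarrow>
    distinct ws \<and> set ws \<subseteq> {1..p + q + p} \<and>
    (\<forall>u\<in>{1..p + q + p}. \<forall>v\<in>{1..p + q + p}.
       (\<forall>w\<in>set ws. bicyclic3_dist p q p u w = bicyclic3_dist p q p v w) \<longrightarrow> u = v)"
proof -
  have rep: "representation (bicyclic3 p q p) ws u = representation (bicyclic3 p q p) ws v \<longleftrightarrow>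
      (\<forall>w\<in>set ws. bicyclic3_dist p q p u w = bicyclic3_dist p q p v w)"
    if "set ws \<subseteq> {1..p + q + p}" "u \<in> {1..p + q + p}" "v \<in> {1..p + q + p}" for u v
    using that gdist_bicyclic3[OF p q p] unfolding representation_def by (simp add: subset_iff)
  have verts: "pverts (bicyclic3 p q p) = {1..p + q + p}" by (simp add: bicyclic3_def)
  show ?thesis
    unfolding resolving_set_def verts using rep by (intro conj_cong refl ball_cong) blast
qed

lemma resolving_set_not_unresolved:
  assumes p: "p \<ge> 1" and q: "q \<ge> 2" and res: "resolving_set (bicyclic3 p q p) ws"
    and sub: "set ws \<subseteq> {w, w'}"
  shows "\<not> unresolved p q w w'"
proof
  assume "unresolved p q w w'"
  then obtain u v where uv: "u \<in> {1..p + q + p}" "v \<in> {1..p + q + p}" "u \<noteq> v"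
    and "bicyclic3_dist p q p u w = bicyclic3_dist p q p v w"
    "bicyclic3_dist p q p u w' = bicyclic3_dist p q p v w'"
    unfolding unresolved_def by blast
  with sub have "\<forall>x\<in>set ws. bicyclic3_dist p q p u x = bicyclic3_dist p q p v x" by auto
  with res uv show False unfolding resolving_set_bicyclic3_iff[OF p q] by blast
qed

theorem theorem7:
  fixes p q r :: nat
  assumes "p \<ge> 1" and "r \<ge> 1" and "q \<ge> 2" and "p = r"
  shows "metric_dimension (bicyclic3 p q r) =
           (if int q - int r = 2 \<or> int q - int r = 4 then 3 else 2)"
proof -
  note p = assms(1) and q = assms(3) and iff = resolving_set_bicyclic3_iff[OF assms(1,3)]
  have least: "metric_dimension (bicyclic3 p q p) = k"
    if "resolving_set (bicyclic3 p q p) ws" "length ws = k"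
      and "\<And>ws'. resolving_set (bicyclic3 p q p) ws' \<Longrightarrow> k \<le> length ws'" for k ws
    unfolding metric_dimension_def using that by (intro Least_equality) blast+
  have "metric_dimension (bicyclic3 p q p) = (if q = p + 2 \<or> q = p + 4 then 3 else 2)"
  proof (cases "q = p + 2 \<or> q = p + 4")
    case True
    then obtain e where e: "q = p + 2 + 2 * e" "e \<le> 1"
      using that[of 0] that[of 1] by auto
    have q1: "q \<ge> p + 1" using e by simp
    have "resolving_set (bicyclic3 p q p) [1, p + 1, p + q + 1]"
      using resolve_wide_triple[OF p q1] p q unfolding iff by auto
    moreover have "3 \<le> length ws" if res: "resolving_set (bicyclic3 p q p) ws" for ws
    proof (rule ccontr)
      assume "\<not> 3 \<le> length ws"
      then have "length ws \<le> 2" by simp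
      moreover have "set ws \<subseteq> {1..p + q + p}" using res unfolding iff by blast
      ultimately obtain w w' where w: "w \<in> {1..p + q + p}" "w' \<in> {1..p + q + p}" "set ws \<subseteq> {w, w'}"
      proof (cases ws rule: remdups_adj.cases)
        case 1
        then show thesis using that[of 1 1] p by simp
      next
        case (2 x)
        then show thesis using that[of x x] \<open>set ws \<subseteq> {1..p + q + p}\<close> by simp
      next
        case (3 x y xs)
        then show thesis using that[of x y] \<open>set ws \<subseteq> {1..p + q + p}\<close> \<open>length ws \<le> 2\<close> by simp
      qed
      then show False
        using resolving_set_not_unresolved[OF p q res] unresolved_all[OF e p] by blast
    qed
    ultimately show ?thesis using True by (subst least[where k = 3]) auto
  next
    case False
    have "\<exists>ws. resolving_set (bicyclic3 p q p) ws \<and> length ws = 2"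
    proof (cases "q \<le> p")
      case True
      define t where "t = (p + q) div 2"
      have t: "q \<le> t" "t \<le> p" using True by (auto simp: t_def)
      have "resolving_set (bicyclic3 p q p) [1, t]"
        using resolve_narrow[OF q True t_def] t q unfolding iff by auto
      then show ?thesis by (intro exI[of _ "[1, t]"]) simp
    next
      case wide: False
      have "u = v" if "u \<in> {1..p + q + p}" "v \<in> {1..p + q + p}"
        "bicyclic3_dist p q p u 1 = bicyclic3_dist p q p v 1"
        "bicyclic3_dist p q p u (p + 2) = bicyclic3_dist p q p v (p + 2)" for u v
      proof (cases "q = p + 1")
        case True
        then show ?thesis using resolve_tight[OF p _ that] by simp
      next
        case False
        with wide \<open>\<not> (q = p + 2 \<or> q = p + 4)\<close> show ?thesis
          using resolve_wide[OF p _ that] by simp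
      qed
      then have "resolving_set (bicyclic3 p q p) [1, p + 2]"
        using p q unfolding iff by auto
      then show ?thesis by (intro exI[of _ "[1, p + 2]"]) simp
    qed
    moreover have "2 \<le> length ws" if res: "resolving_set (bicyclic3 p q p) ws" for ws
    proof (rule ccontr)
      assume "\<not> 2 \<le> length ws"
      then have "length ws \<le> 1" by simp
      then obtain w where "set ws \<subseteq> {w, w}"
        by (cases ws) auto
      then show False
        using resolving_set_not_unresolved[OF p q res] unresolved_single[OF p q] by blast
    qed
    ultimately show ?thesis using False by (metis least)
  qed
  then show ?thesis using assms(4) by auto
qed

end
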